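(* Let $r\geq 2$ be an integer and let $0<\varepsilon\leq 1/2$. Then there is $\delta=\delta(\varepsilon)>0$ such that for all sufficiently large $n$, \[ \left(1-\frac1r\right)\binom{n}{2}\;\leq\;\log_2\left|\mathcal{P}_n\Big(K_{r+1}\big(\lfloor \delta\log n\rfloor;\lceil n^{1-\sqrt{\delta}}\rceil\big)\Big)\right|\;\leq\;\left(1-\frac1r+\varepsilon\right)\binom{n}{2}. \]
   Context: $\log$ denotes the natural logarithm. For integers $r\geq 2$, $p\geq1$, $q\geq1$, $K_{r+1}(p;q)$ denotes the complete $(r+1)$-partite graph with $r$ parts of size $p$ and one part of size $q$. For a graph $F$, $\mathcal{P}_n(F)$ denotes the set of all labelled graphs on the vertex set $\{1,\dots,n\}$ that do not contain $F$ as a (not necessarily induced) subgraph. *)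

theory Defs
  imports Complex_Main "HOL-Library.Ramsey"
begin

text \<open>A graph is a pair of a vertex set and a set of edges, an edge being a two-element
  set of vertices; \<open>nsets V 2\<close> is the set of all two-element subsets of \<open>V\<close>.\<close>

type_synonym 'a graph = "'a set \<times> 'a set set"

abbreviation verts :: "'a graph \<Rightarrow> 'a set" where
  "verts G \<equiv> fst G"

abbreviation edges :: "'a graph \<Rightarrow> 'a set set" where
  "edges G \<equiv> snd G"

definition labelled_graphs :: "nat \<Rightarrow> nat graph set" where
  "labelled_graphs n = {G. verts G = {1..n} \<and> edges G \<subseteq> nsets {1..n} 2}"

text \<open>\<open>G\<close> has a (not necessarily induced) subgraph isomorphic to \<open>F\<close>.\<close>

definition contains_copy :: "'a graph \<Rightarrow> 'b graph \<Rightarrow> bool" where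
  "contains_copy G F \<longleftrightarrow>
     (\<exists>f. inj_on f (verts F) \<and> f ` verts F \<subseteq> verts G \<and> (\<forall>e\<in>edges F. f ` e \<in> edges G))"

definition free_graphs :: "nat \<Rightarrow> 'b graph \<Rightarrow> nat graph set" where
  "free_graphs n F = {G \<in> labelled_graphs n. \<not> contains_copy G F}"

text \<open>The complete \<open>k\<close>-partite graph whose \<open>i\<close>-th part, \<open>{i} \<times> {..<s i}\<close>, has size \<open>s i\<close>.\<close>

definition complete_multipartite :: "nat \<Rightarrow> (nat \<Rightarrow> nat) \<Rightarrow> (nat \<times> nat) graph" where
  "complete_multipartite k s =
     (let V = (SIGMA i:{..<k}. {..<s i})
      in (V, {{u, v} | u v. u \<in> V \<and> v \<in> V \<and> fst u \<noteq> fst v}))"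

text \<open>\<open>K_multi r p q\<close> is \<open>K\<^bsub>r+1\<^esub>(p;q)\<close>: the parts \<open>0, \<dots>, r - 1\<close> have size \<open>p\<close>, part \<open>r\<close> has size \<open>q\<close>.\<close>

definition K_multi :: "nat \<Rightarrow> nat \<Rightarrow> nat \<Rightarrow> (nat \<times> nat) graph" where
  "K_multi r p q = complete_multipartite (r + 1) (\<lambda>i. if i < r then p else q)"

end

theory Submission
  imports Defs "HOL-Real_Asymp.Real_Asymp"
begin

text \<open>The lower bound counts the subgraphs of a Turan graph. The upper bound is an induction on
  \<open>r\<close> that avoids the regularity lemma. Put \<open>T = K p\<close> for a large constant \<open>K\<close>, and let \<open>G\<close> be a
  \<open>K\<^bsub>r+1\<^esub>(p;q)\<close>-free graph. If \<open>G\<close> contains no complete \<open>r\<close>-partite graph with parts of size \<open>T\<close>,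
  the induction hypothesis applies. Otherwise fix such a subgraph. Fewer than \<open>q\<close> vertices can be
  joined to all of a given choice of \<open>p\<close>-subsets of the parts, so all but \<open>q\<close> times
  \<open>(T choose p)\<^sup>r\<close> vertices have fewer than \<open>p\<close> neighbours in some part, and each of these is attached
  in about \<open>2\<close> to the power \<open>(r - 1 + o(1)) T\<close> ways. Deleting the \<open>r T\<close> vertices and iterating gives
  the exponent \<open>(1 - 1/r + o(1)) n\<^sup>2/2\<close>. For \<open>r \<ge> 1/\<epsilon>\<close> the upper bound is trivial, which makes
  \<open>\<delta>\<close> independent of \<open>r\<close>.\<close>

section \<open>Complete multipartite subgraphs\<close>

text \<open>If \<open>E\<close> consists of two-element sets, the parts are automatically disjoint:
  a common vertex \<open>u\<close> would require the edge \<open>{u, u} = {u}\<close>. Edges inside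
  a part are allowed, as the subgraph need not be induced.\<close>

definition spans :: "nat \<Rightarrow> (nat \<Rightarrow> 'a set) \<Rightarrow> 'a set set \<Rightarrow> bool" where
  "spans k P E \<longleftrightarrow> (\<forall>i<k. \<forall>j<k. i \<noteq> j \<longrightarrow> (\<forall>u\<in>P i. \<forall>v\<in>P j. {u, v} \<in> E))"

definition has_multi :: "nat \<Rightarrow> (nat \<Rightarrow> nat) \<Rightarrow> 'a set \<Rightarrow> 'a set set \<Rightarrow> bool" where
  "has_multi k s V E \<longleftrightarrow> (\<exists>P. (\<forall>i<k. P i \<subseteq> V \<and> card (P i) = s i) \<and> spans k P E)"

text \<open>Graphs are represented by their edge sets over an arbitrary \<open>V\<close> rather than
  \<open>{1..n}\<close>, because deleting vertices leaves arbitrary sets of labels.\<close>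

definition multi_free :: "nat \<Rightarrow> (nat \<Rightarrow> nat) \<Rightarrow> 'a set \<Rightarrow> 'a set set set" where
  "multi_free k s V = {E. E \<subseteq> nsets V 2 \<and> \<not> has_multi k s V E}"

abbreviation part_sizes :: "nat \<Rightarrow> nat \<Rightarrow> nat \<Rightarrow> nat \<Rightarrow> nat" where
  "part_sizes r p q \<equiv> \<lambda>i. if i < r then p else q"

lemma doubleton_notin_nsets: "{u} \<notin> nsets V 2"
  by (auto simp: nsets_def)

lemma spans_disjoint:
  assumes "spans k P E" "E \<subseteq> nsets V 2" "i < k" "j < k" "i \<noteq> j"
  shows "P i \<inter> P j = {}"
proof (rule ccontr)
  assume "P i \<inter> P j \<noteq> {}"
  then obtain u where "u \<in> P i" "u \<in> P j" by blast
  then have "{u, u} \<in> E" using assms unfolding spans_def by blast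
  with assms(2) show False using doubleton_notin_nsets[of u V] by auto
qed

lemma finite_nsets2: "finite V \<Longrightarrow> finite (nsets V 2)"
  by (rule finite_imp_finite_nsets)

lemma finite_multi_free: "finite V \<Longrightarrow> finite (multi_free k s V)"
  unfolding multi_free_def
  by (rule finite_subset[of _ "Pow (nsets V 2)"]) (auto intro: finite_nsets2)

lemma card_nsets2_le: "finite V \<Longrightarrow> card (nsets V 2) \<le> (card V)\<^sup>2"
  by (auto simp: choose_two power2_eq_square intro!: order_trans[OF div_le_dividend] mult_le_mono)

lemma card_multi_free_le_power:
  assumes "finite V"
  shows "card (multi_free k s V) \<le> 2 ^ ((card V)\<^sup>2)"
proof -
  have "card (multi_free k s V) \<le> card (Pow (nsets V 2))"
    unfolding multi_free_def by (rule card_mono) (auto intro: finite_nsets2 assms)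
  also have "\<dots> = 2 ^ card (nsets V 2)"
    by (simp add: card_Pow finite_nsets2 assms)
  also have "\<dots> \<le> 2 ^ ((card V)\<^sup>2)"
    using card_nsets2_le[OF assms] by (intro power_increasing) auto
  finally show ?thesis .
qed

lemma card_subsets_card_less:
  assumes "finite A"
  shows "card {S. S \<subseteq> A \<and> card S < p} \<le> (\<Sum>k\<le>p. card A choose k)"
proof -
  have "{S. S \<subseteq> A \<and> card S < p} \<subseteq> (\<Union>k\<in>{..p}. {S. S \<subseteq> A \<and> card S = k})"
    by auto
  then have "card {S. S \<subseteq> A \<and> card S < p} \<le> card (\<Union>k\<in>{..p}. {S. S \<subseteq> A \<and> card S = k})"
    using assms by (intro card_mono) auto
  also have "\<dots> \<le> (\<Sum>k\<le>p. card {S. S \<subseteq> A \<and> card S = k})"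
    by (rule card_UN_le) auto
  also have "\<dots> = (\<Sum>k\<le>p. card A choose k)"
    using assms by (simp add: n_subsets)
  finally show ?thesis .
qed

text \<open>\<open>S\<close> is determined by \<open>S \<inter> A\<close>, which is small, and
  \<open>S - A\<close>, which is arbitrary. With \<open>A\<close> a part of a multipartite subgraph
  on \<open>U\<close>, this counts the neighbourhoods that have fewer than \<open>p\<close> vertices
  in that part.\<close>

lemma card_subsets_meeting_less:
  assumes "finite U" "A \<subseteq> U"
  shows "card {S. S \<subseteq> U \<and> card (S \<inter> A) < p} \<le> (\<Sum>k\<le>p. card A choose k) * 2 ^ (card U - card A)"
proof -
  have fin: "finite A" using assms finite_subset by blast
  let ?X = "{S. S \<subseteq> A \<and> card S < p} \<times> Pow (U - A)"
  have "card {S. S \<subseteq> U \<and> card (S \<inter> A) < p} \<le> card ?X"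
  proof (rule card_inj_on_le)
    show "inj_on (\<lambda>S. (S \<inter> A, S - A)) {S. S \<subseteq> U \<and> card (S \<inter> A) < p}"
      by (rule inj_onI) blast
    show "finite ?X" using assms fin by auto
  qed auto
  also have "\<dots> = card {S. S \<subseteq> A \<and> card S < p} * 2 ^ (card U - card A)"
    using assms fin by (simp add: card_cartesian_product card_Pow card_Diff_subset)
  also have "\<dots> \<le> (\<Sum>k\<le>p. card A choose k) * 2 ^ (card U - card A)"
    by (intro mult_right_mono card_subsets_card_less fin) auto
  finally show ?thesis .
qed

section \<open>Attaching vertices to a complete multipartite subgraph\<close>

text \<open>Double counting: an exceptional vertex \<open>w\<close> selects a
  \<open>p\<close>-subset \<open>A i\<close> of its neighbours in every \<open>P i\<close>. There
  are \<open>(T choose p) ^ r\<close> selections, and more than \<open>q\<close> vertices making the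
  same one would complete the forbidden graph.\<close>

lemma card_exceptional:
  fixes P :: "nat \<Rightarrow> 'a set"
  assumes V: "finite V" and E: "E \<in> multi_free (Suc r) (part_sizes r p q) V"
    and P: "\<And>i. i < r \<Longrightarrow> P i \<subseteq> V" "\<And>i. i < r \<Longrightarrow> card (P i) = T" "spans r P E"
  shows "card {w\<in>V. \<forall>i<r. p \<le> card {u\<in>P i. {w, u} \<in> E}} \<le> q * (T choose p) ^ r"
proof -
  let ?N = "\<lambda>w i. {u\<in>P i. {w, u} \<in> E}"
  let ?Z = "PiE {..<r} (\<lambda>i. {S. S \<subseteq> P i \<and> card S = p})"
  let ?F = "\<lambda>A. {w\<in>V. \<forall>i<r. A i \<subseteq> ?N w i}"
  have finP: "finite (P i)" if "i < r" for i
    using P(1)[OF that] V finite_subset by blast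
  have finZ: "finite ?Z" using finP by (intro finite_PiE) auto
  have sub: "{w\<in>V. \<forall>i<r. p \<le> card (?N w i)} \<subseteq> (\<Union>A\<in>?Z. ?F A)"
  proof
    fix w assume w: "w \<in> {w\<in>V. \<forall>i<r. p \<le> card (?N w i)}"
    have "\<forall>i\<in>{..<r}. \<exists>S. S \<subseteq> ?N w i \<and> card S = p"
    proof
      fix i assume "i \<in> {..<r}"
      then have "p \<le> card (?N w i)" using w by blast
      then show "\<exists>S. S \<subseteq> ?N w i \<and> card S = p" by (rule obtain_subset_with_card_n) blast
    qed
    from bchoice[OF this] obtain A where "\<forall>i\<in>{..<r}. A i \<subseteq> ?N w i \<and> card (A i) = p" ..
    then have A: "\<And>i. i < r \<Longrightarrow> A i \<subseteq> ?N w i \<and> card (A i) = p" by blast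
    then have "restrict A {..<r} \<in> ?Z" by fastforce
    moreover have "w \<in> ?F (restrict A {..<r})" using A w by auto
    ultimately show "w \<in> (\<Union>A\<in>?Z. ?F A)" by blast
  qed
  have fib: "card (?F A) \<le> q" if A: "A \<in> ?Z" for A
  proof (rule ccontr)
    assume "\<not> card (?F A) \<le> q"
    then have "q \<le> card (?F A)" by simp
    then obtain Q where Q: "Q \<subseteq> ?F A" "card Q = q" by (rule obtain_subset_with_card_n) blast
    \<comment> \<open>\<open>Q\<close> may meet \<open>P i\<close> but not \<open>A i\<close>, since
      each of its vertices is adjacent to all of \<open>A i\<close>.\<close>
    define P' where "P' = (\<lambda>i. if i < r then A i else Q)"
    have AP: "A i \<subseteq> P i" "card (A i) = p" if "i < r" for i
      using A that by (auto simp: PiE_iff)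
    have "spans (Suc r) P' E"
      unfolding spans_def
    proof (intro allI impI ballI)
      fix i j u v assume ij: "i < Suc r" "j < Suc r" "i \<noteq> j" and uv: "u \<in> P' i" "v \<in> P' j"
      consider "i < r" "j < r" | "i < r" "j = r" | "i = r" "j < r" using ij by linarith
      then show "{u, v} \<in> E"
      proof cases
        case 1
        then have "u \<in> P i" "v \<in> P j" using uv AP unfolding P'_def by auto
        then show ?thesis using 1 P(3) ij(3) unfolding spans_def by blast
      next
        case 2
        then have "u \<in> ?N v i" using uv Q unfolding P'_def by auto
        then show ?thesis by (simp add: insert_commute)
      next
        case 3
        then have "v \<in> ?N u j" using uv Q unfolding P'_def by auto
        then show ?thesis by simp
      qed
    qed
    moreover have "\<forall>i<Suc r. P' i \<subseteq> V \<and> card (P' i) = part_sizes r p q i"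
    proof (intro allI impI)
      fix i assume "i < Suc r"
      show "P' i \<subseteq> V \<and> card (P' i) = part_sizes r p q i"
      proof (cases "i < r")
        case True
        then show ?thesis using AP[OF True] P(1)[OF True] unfolding P'_def by simp
      next
        case False
        moreover have "Q \<subseteq> V" using Q(1) by blast
        ultimately show ?thesis using Q(2) unfolding P'_def by simp
      qed
    qed
    ultimately have "has_multi (Suc r) (part_sizes r p q) V E"
      unfolding has_multi_def by blast
    then show False using E unfolding multi_free_def by blast
  qed
  have "card {w\<in>V. \<forall>i<r. p \<le> card (?N w i)} \<le> card (\<Union>A\<in>?Z. ?F A)"
    using sub finZ V by (intro card_mono) auto
  also have "\<dots> \<le> (\<Sum>A\<in>?Z. card (?F A))" by (rule card_UN_le[OF finZ])
  also have "\<dots> \<le> (\<Sum>A\<in>?Z. q)" by (rule sum_mono) (rule fib)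
  also have "\<dots> = q * card ?Z" by simp
  also have "card ?Z = (\<Prod>i<r. card {S. S \<subseteq> P i \<and> card S = p})" by (simp add: card_PiE)
  also have "\<dots> = (\<Prod>i<r. T choose p)"
    using P finP by (intro prod.cong) (auto simp: n_subsets)
  finally show ?thesis by simp
qed

text \<open>\<open>g w\<close> stands for the neighbourhood of \<open>w\<close> in \<open>U\<close>.
  First the exceptional set is chosen, in at most \<open>2 ^ card W\<close> ways. Each of its at
  most \<open>X\<close> vertices then has \<open>2 ^ (r * T)\<close> possible neighbourhoods. Every
  other vertex picks a part it meets in fewer than \<open>p\<close> vertices, which leaves only
  about \<open>(r - 1) * T\<close> free bits.\<close>

lemma card_attachments:
  assumes W: "finite W" and U: "finite U" and r: "0 < r"
    and P: "\<And>i. i < r \<Longrightarrow> P i \<subseteq> U" "\<And>i. i < r \<Longrightarrow> card (P i) = T"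
    and cU: "card U = r * T"
  shows "card {g \<in> W \<rightarrow>\<^sub>E Pow U. card {w\<in>W. \<forall>i<r. p \<le> card (g w \<inter> P i)} \<le> X}
    \<le> 2 ^ card W * (2 ^ (r * T * X) * (r * (\<Sum>k\<le>p. T choose k) * 2 ^ ((r - 1) * T)) ^ card W)"
proof -
  define L where "L = r * (\<Sum>k\<le>p. T choose k) * 2 ^ ((r - 1) * T)"
  let ?Low = "{S. S \<subseteq> U \<and> (\<exists>i<r. card (S \<inter> P i) < p)}"
  have L1: "L \<ge> 1"
  proof -
    have "(\<Sum>k\<le>p. T choose k) \<ge> T choose 0" by (rule member_le_sum) auto
    then show ?thesis using r unfolding L_def by auto
  qed
  have low: "card ?Low \<le> L"
  proof -
    have "?Low = (\<Union>i<r. {S. S \<subseteq> U \<and> card (S \<inter> P i) < p})" by auto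
    then have "card ?Low \<le> (\<Sum>i<r. card {S. S \<subseteq> U \<and> card (S \<inter> P i) < p})"
      by (simp add: card_UN_le)
    also have "\<dots> \<le> (\<Sum>i<r. (\<Sum>k\<le>p. T choose k) * 2 ^ ((r - 1) * T))"
    proof (rule sum_mono)
      fix i assume "i \<in> {..<r}"
      then show "card {S. S \<subseteq> U \<and> card (S \<inter> P i) < p} \<le> (\<Sum>k\<le>p. T choose k) * 2 ^ ((r - 1) * T)"
        using card_subsets_meeting_less[OF U P(1), of i p] P(2)[of i] cU
        by (simp add: diff_mult_distrib)
    qed
    finally show ?thesis by (simp add: L_def)
  qed
  let ?D = "\<lambda>X'. PiE W (\<lambda>w. if w \<in> X' then Pow U else ?Low)"
  let ?I = "{X'. X' \<subseteq> W \<and> card X' \<le> X}"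
  have finI: "finite ?I" using W by auto
  have finLow: "finite ?Low" using U by auto
  have finD: "finite (?D X')" for X' using W U by (intro finite_PiE) auto
  have cD: "card (?D X') \<le> 2 ^ (r * T * X) * L ^ card W" if X': "X' \<in> ?I" for X'
  proof -
    have "card (?D X') = (\<Prod>w\<in>W. card (if w \<in> X' then Pow U else ?Low))"
      by (rule card_PiE[OF W])
    \<comment> \<open>Exceptional vertices are charged a factor \<open>L \<ge> 1\<close> as well, so
      that the bound depends on \<open>X'\<close> only through its size.\<close>
    also have "\<dots> \<le> (\<Prod>w\<in>W. (if w \<in> X' then 2 ^ (r * T) else 1) * L)"
    proof (rule prod_mono, intro conjI)
      fix w assume "w \<in> W"
      show "card (if w \<in> X' then Pow U else ?Low) \<le> (if w \<in> X' then 2 ^ (r * T) else 1) * L"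
        using L1 low U cU by (auto simp: card_Pow)
    qed auto
    also have "\<dots> = (\<Prod>w\<in>W. if w \<in> X' then 2 ^ (r * T) else 1) * L ^ card W"
      by (simp add: prod.distrib)
    also have "(\<Prod>w\<in>W. if w \<in> X' then 2 ^ (r * T) else (1::nat)) = (\<Prod>w\<in>X'. 2 ^ (r * T))"
      using X' W by (simp add: prod.inter_restrict[symmetric] Int_absorb1)
    also have "\<dots> = 2 ^ (r * T * card X')" by (simp add: power_mult)
    also have "\<dots> \<le> 2 ^ (r * T * X)" using X' by (intro power_increasing) auto
    finally show ?thesis by simp
  qed
  have "{g \<in> W \<rightarrow>\<^sub>E Pow U. card {w\<in>W. \<forall>i<r. p \<le> card (g w \<inter> P i)} \<le> X} \<subseteq> (\<Union>X'\<in>?I. ?D X')"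
  proof
    fix g assume g: "g \<in> {g \<in> W \<rightarrow>\<^sub>E Pow U. card {w\<in>W. \<forall>i<r. p \<le> card (g w \<inter> P i)} \<le> X}"
    let ?X' = "{w\<in>W. \<forall>i<r. p \<le> card (g w \<inter> P i)}"
    have "g \<in> ?D ?X'" using g by (auto simp: PiE_iff not_le)
    moreover have "?X' \<in> ?I" using g by auto
    ultimately show "g \<in> (\<Union>X'\<in>?I. ?D X')" by blast
  qed
  then have "card {g \<in> W \<rightarrow>\<^sub>E Pow U. card {w\<in>W. \<forall>i<r. p \<le> card (g w \<inter> P i)} \<le> X}
      \<le> card (\<Union>X'\<in>?I. ?D X')"
    using finI finD by (intro card_mono) auto
  also have "\<dots> \<le> (\<Sum>X'\<in>?I. card (?D X'))" by (rule card_UN_le[OF finI])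
  also have "\<dots> \<le> (\<Sum>X'\<in>?I. 2 ^ (r * T * X) * L ^ card W)" by (rule sum_mono) (rule cD)
  also have "\<dots> = card ?I * (2 ^ (r * T * X) * L ^ card W)" by simp
  also have "card ?I \<le> 2 ^ card W"
    using W card_mono[of "Pow W" ?I] by (auto simp: card_Pow)
  finally show ?thesis unfolding L_def by simp
qed

section \<open>Splitting a graph along a multipartite subgraph\<close>

lemma has_multi_mono:
  assumes "has_multi k s W E" "W \<subseteq> V" "E \<subseteq> E'"
  shows "has_multi k s V E'"
proof -
  obtain P where P: "\<forall>i<k. P i \<subseteq> W \<and> card (P i) = s i" "spans k P E"
    using assms(1) unfolding has_multi_def by blast
  have "spans k P E'" using P(2) assms(3) unfolding spans_def by blast
  with P(1) assms(2) show ?thesis unfolding has_multi_def by blast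
qed

lemma multi_free_restrict:
  assumes "E \<in> multi_free k s V" "W \<subseteq> V"
  shows "E \<inter> nsets W 2 \<in> multi_free k s W"
  using assms has_multi_mono[of k s W "E \<inter> nsets W 2" V E] unfolding multi_free_def by blast

lemma nsets2_cases:
  assumes "e \<in> nsets V 2" "V = U \<union> W"
  obtains "e \<in> nsets U 2" | "e \<in> nsets W 2"
    | w u where "w \<in> W" "u \<in> U" "e = {w, u}"
proof -
  obtain x y where xy: "e = {x, y}" "x \<in> V" "y \<in> V" "x \<noteq> y"
    using assms(1) by (auto simp: nsets_def card_2_iff)
  consider "x \<in> U" "y \<in> U" | "x \<in> W" "y \<in> W" | "x \<in> W" "y \<in> U" | "x \<in> U" "y \<in> W"
    using xy assms(2) by blast
  then show ?thesis
  proof cases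
    case 1
    then show ?thesis using xy that(1) by (simp add: nsets_def)
  next
    case 2
    then show ?thesis using xy that(2) by (simp add: nsets_def)
  next
    case 3
    then show ?thesis using xy that(3) by blast
  next
    case 4
    then show ?thesis using xy that(3)[of y x] by (simp add: insert_commute)
  qed
qed

text \<open>Every edge lies inside \<open>W\<close>, lies inside \<open>U\<close>, or joins the two,
  so these three pieces recover the graph. Counting graphs thus reduces to a product of three
  counts.\<close>

lemma inj_on_split_edges:
  assumes "V = U \<union> W"
  shows "inj_on (\<lambda>E. (E \<inter> nsets W 2, E \<inter> nsets U 2, \<lambda>w\<in>W. {u\<in>U. {w, u} \<in> E})) (Pow (nsets V 2))"
proof (rule inj_onI)
  have aux: "e \<in> E'" if "e \<in> E" "E \<subseteq> nsets V 2" "E \<inter> nsets W 2 = E' \<inter> nsets W 2"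
     "E \<inter> nsets U 2 = E' \<inter> nsets U 2"
     "(\<lambda>w\<in>W. {u\<in>U. {w, u} \<in> E}) = (\<lambda>w\<in>W. {u\<in>U. {w, u} \<in> E'})" for e E E'
  proof -
    have "e \<in> nsets V 2" using that by blast
    then show ?thesis using assms
    proof (cases rule: nsets2_cases)
      case (3 w u)
      have "{u\<in>U. {w, u} \<in> E} = {u\<in>U. {w, u} \<in> E'}"
        using fun_cong[OF that(5), of w] 3(1) by simp
      then show ?thesis using 3 that(1) by blast
    qed (use that in blast)+
  qed
  fix E E'
  assume "E \<in> Pow (nsets V 2)" "E' \<in> Pow (nsets V 2)"
    and eq: "(E \<inter> nsets W 2, E \<inter> nsets U 2, \<lambda>w\<in>W. {u\<in>U. {w, u} \<in> E})
      = (E' \<inter> nsets W 2, E' \<inter> nsets U 2, \<lambda>w\<in>W. {u\<in>U. {w, u} \<in> E'})"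
  then show "E = E'"
    using aux[of _ E E'] aux[of _ E' E] by (metis (no_types, lifting) Pow_iff prod.inject subsetI subset_antisym)
qed

text \<open>The factors count, in this order, the graph left on \<open>W\<close> after deleting the
  \<open>r * T\<close> vertices of the fixed parts, the graph on those vertices, and the attachments
  between the two. The size condition on \<open>W\<close> is additive, so that it becomes
  unsatisfiable when \<open>V\<close> has fewer than \<open>r * T\<close> vertices.\<close>

lemma card_multi_free_spans:
  fixes P :: "nat \<Rightarrow> 'a set"
  defines "L \<equiv> \<lambda>r T p. r * (\<Sum>k\<le>p. T choose k) * 2 ^ ((r - 1) * T)"
  assumes V: "finite V" and r: "0 < r"
    and P: "\<And>i. i < r \<Longrightarrow> P i \<subseteq> V" "\<And>i. i < r \<Longrightarrow> card (P i) = T"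
    and M: "\<And>W. W \<subseteq> V \<Longrightarrow> card W + r * T = card V
              \<Longrightarrow> card (multi_free (Suc r) (part_sizes r p q) W) \<le> M"
  shows "card {E \<in> multi_free (Suc r) (part_sizes r p q) V. spans r P E}
    \<le> M * (2 ^ (r * T)\<^sup>2 * (2 ^ card V * (2 ^ (r * T * (q * (T choose p) ^ r)) * L r T p ^ card V)))"
    (is "card ?G \<le> _")
proof (cases "?G = {}")
  case False
  \<comment> \<open>Any member of \<open>?G\<close> forces the parts \<open>P i\<close> to be
    pairwise disjoint, which yields \<open>card U = r * T\<close>.\<close>
  then obtain E0 where E0: "E0 \<subseteq> nsets V 2" "spans r P E0"
    unfolding multi_free_def by blast
  define U where "U = (\<Union>i<r. P i)"
  define W where "W = V - U"
  let ?X = "q * (T choose p) ^ r"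
  have UV: "U \<subseteq> V" using P(1) unfolding U_def by blast
  have fin: "finite U" "finite W" using UV V finite_subset unfolding W_def by auto
  have cU: "card U = r * T"
  proof -
    have "card U = (\<Sum>i<r. card (P i))"
      unfolding U_def
    proof (rule card_UN_disjoint)
      show "\<forall>i\<in>{..<r}. finite (P i)" using P(1) V finite_subset by blast
      show "\<forall>i\<in>{..<r}. \<forall>j\<in>{..<r}. i \<noteq> j \<longrightarrow> P i \<inter> P j = {}"
        using spans_disjoint[OF E0(2,1)] by blast
    qed simp
    then show ?thesis using P(2) by simp
  qed
  have cW: "card W + r * T = card V"
    using cU UV V fin card_mono[OF V UV] unfolding W_def by (simp add: card_Diff_subset)
  let ?A = "{g \<in> W \<rightarrow>\<^sub>E Pow U. card {w\<in>W. \<forall>i<r. p \<le> card (g w \<inter> P i)} \<le> ?X}"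
  let ?h = "\<lambda>E. (E \<inter> nsets W 2, E \<inter> nsets U 2, \<lambda>w\<in>W. {u\<in>U. {w, u} \<in> E})"
  let ?R = "multi_free (Suc r) (part_sizes r p q) W \<times> Pow (nsets U 2) \<times> ?A"
  have finA: "finite ?A"
    by (rule finite_subset[of _ "W \<rightarrow>\<^sub>E Pow U"]) (use fin in \<open>auto intro: finite_PiE\<close>)
  have "card ?G \<le> card ?R"
  proof (rule card_inj_on_le)
    show "inj_on ?h ?G"
    proof (rule inj_on_subset)
      show "inj_on ?h (Pow (nsets V 2))"
        by (rule inj_on_split_edges) (use UV W_def in blast)
      show "?G \<subseteq> Pow (nsets V 2)" unfolding multi_free_def by blast
    qed
    show "?h ` ?G \<subseteq> ?R"
    proof
      fix y assume "y \<in> ?h ` ?G"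
      then obtain E where E: "E \<in> multi_free (Suc r) (part_sizes r p q) V" "spans r P E"
        and y: "y = ?h E" by blast
      let ?g = "\<lambda>w\<in>W. {u\<in>U. {w, u} \<in> E}"
      have "?g w \<inter> P i = {u\<in>P i. {w, u} \<in> E}" if "w \<in> W" "i < r" for w i
        using that unfolding U_def by auto
      then have "{w\<in>W. \<forall>i<r. p \<le> card (?g w \<inter> P i)} \<subseteq> {w\<in>V. \<forall>i<r. p \<le> card {u\<in>P i. {w, u} \<in> E}}"
        unfolding W_def by auto
      then have "card {w\<in>W. \<forall>i<r. p \<le> card (?g w \<inter> P i)}
          \<le> card {w\<in>V. \<forall>i<r. p \<le> card {u\<in>P i. {w, u} \<in> E}}"
        using V by (intro card_mono) auto
      also have "\<dots> \<le> ?X" by (rule card_exceptional[OF V E(1) P E(2)])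
      finally have "?g \<in> ?A" by auto
      moreover have "E \<inter> nsets W 2 \<in> multi_free (Suc r) (part_sizes r p q) W"
        by (rule multi_free_restrict[OF E(1)]) (simp add: W_def)
      ultimately show "y \<in> ?R" unfolding y by blast
    qed
    show "finite ?R"
      using finA fin by (intro finite_cartesian_product finite_multi_free) (auto intro: finite_nsets2)
  qed
  also have "\<dots> = card (multi_free (Suc r) (part_sizes r p q) W) * (2 ^ card (nsets U 2) * card ?A)"
    using fin by (simp add: card_cartesian_product card_Pow finite_nsets2)
  also have "\<dots> \<le> M * (2 ^ (r * T)\<^sup>2 * (2 ^ card V * (2 ^ (r * T * ?X) * L r T p ^ card V)))"
  proof (intro mult_le_mono)
    show "card (multi_free (Suc r) (part_sizes r p q) W) \<le> M"
      by (rule M) (use cW W_def in auto)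
    show "(2::nat) ^ card (nsets U 2) \<le> 2 ^ (r * T)\<^sup>2"
      using card_nsets2_le[OF fin(1)] cU by (intro power_increasing) auto
    have "(\<Sum>k\<le>p. T choose k) \<ge> T choose 0" by (rule member_le_sum) auto
    then have L1: "1 \<le> L r T p" using r unfolding L_def by auto
    have "card ?A \<le> 2 ^ card W * (2 ^ (r * T * ?X) * L r T p ^ card W)"
      unfolding L_def by (rule card_attachments[OF fin(2,1) r _ P(2) cU]) (auto simp: U_def)
    also have "\<dots> \<le> 2 ^ card V * (2 ^ (r * T * ?X) * L r T p ^ card V)"
      by (rule mult_le_mono[OF power_increasing mult_le_mono2[OF power_increasing]]) (use cW L1 in auto)
    finally show "card ?A \<le> 2 ^ card V * (2 ^ (r * T * ?X) * L r T p ^ card V)" .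
  qed
  finally show ?thesis .
next
  case True
  show ?thesis unfolding True by simp
qed

text \<open>Either the graph has no complete \<open>r\<close>-partite subgraph with parts of size
  \<open>T\<close>, or one such subgraph is fixed. Its parts are \<open>r\<close> subsets of
  \<open>V\<close>, hence the crude factor \<open>(2 ^ card V) ^ r\<close>.\<close>

lemma card_multi_free_step:
  fixes V :: "'a set"
  defines "L \<equiv> \<lambda>r T p. r * (\<Sum>k\<le>p. T choose k) * 2 ^ ((r - 1) * T)"
  assumes V: "finite V" and r: "0 < r"
    and M: "\<And>W. W \<subseteq> V \<Longrightarrow> card W + r * T = card V
              \<Longrightarrow> card (multi_free (Suc r) (part_sizes r p q) W) \<le> M"
  shows "card (multi_free (Suc r) (part_sizes r p q) V)
    \<le> card (multi_free r (\<lambda>_. T) V) +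
       (2 ^ card V) ^ r * (M * (2 ^ (r * T)\<^sup>2 *
         (2 ^ card V * (2 ^ (r * T * (q * (T choose p) ^ r)) * L r T p ^ card V))))"
    (is "card ?F \<le> card ?F' + _ * ?B")
proof -
  let ?Z = "{P \<in> {..<r} \<rightarrow>\<^sub>E Pow V. \<forall>i<r. card (P i) = T}"
  let ?G = "\<lambda>P. {E \<in> ?F. spans r P E}"
  have finE: "finite ({..<r} \<rightarrow>\<^sub>E Pow V)" using V by (intro finite_PiE) auto
  then have finZ: "finite ?Z" by auto
  have finG: "finite (?G P)" for P using finite_multi_free[OF V] by (rule rev_finite_subset) blast
  have "?F \<subseteq> ?F' \<union> (\<Union>P\<in>?Z. ?G P)"
  proof
    fix E assume E: "E \<in> ?F"
    show "E \<in> ?F' \<union> (\<Union>P\<in>?Z. ?G P)"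
    proof (cases "has_multi r (\<lambda>_. T) V E")
      case True
      then obtain P where P: "\<forall>i<r. P i \<subseteq> V \<and> card (P i) = T" "spans r P E"
        unfolding has_multi_def by blast
      have "restrict P {..<r} \<in> ?Z" using P(1) by auto
      moreover have "spans r (restrict P {..<r}) E" using P(2) unfolding spans_def by simp
      ultimately show ?thesis using E by blast
    next
      case False
      then show ?thesis using E unfolding multi_free_def by blast
    qed
  qed
  then have "card ?F \<le> card (?F' \<union> (\<Union>P\<in>?Z. ?G P))"
    by (intro card_mono finite_UnI finite_UN_I finite_multi_free V finZ finG)
  also have "\<dots> \<le> card ?F' + card (\<Union>P\<in>?Z. ?G P)" by (rule card_Un_le)
  also have "card (\<Union>P\<in>?Z. ?G P) \<le> (\<Sum>P\<in>?Z. card (?G P))" by (rule card_UN_le[OF finZ])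
  also have "\<dots> \<le> (\<Sum>P\<in>?Z. ?B)"
  proof (rule sum_mono)
    fix P assume P: "P \<in> ?Z"
    show "card (?G P) \<le> ?B"
      unfolding L_def by (rule card_multi_free_spans[OF V r _ _ M]) (use P in auto)
  qed
  also have "\<dots> = card ?Z * ?B" by simp
  also have "\<dots> \<le> (2 ^ card V) ^ r * ?B"
  proof (rule mult_le_mono1)
    have "card ?Z \<le> card ({..<r} \<rightarrow>\<^sub>E Pow V)" using finE by (intro card_mono) auto
    then show "card ?Z \<le> (2 ^ card V) ^ r" using V by (simp add: card_PiE card_Pow)
  qed
  finally show ?thesis by simp
qed

section \<open>Iterating the deletion step\<close>

text \<open>Compares the sum with the binomial expansion of \<open>(1 + 1/K) ^ (K p)\<close>.\<close>

lemma sum_choose_le: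
  fixes K p :: nat
  assumes K: "1 \<le> K"
  shows "real (\<Sum>k\<le>p. (K * p) choose k) \<le> (exp 1 * real K) ^ p"
proof -
  let ?T = "K * p" and ?x = "1 / real K"
  have K0: "0 < real K" using K by simp
  have pT: "p \<le> ?T" using K by simp
  have "real (\<Sum>k\<le>p. ?T choose k) * ?x ^ p = (\<Sum>k\<le>p. real (?T choose k) * ?x ^ p)"
    by (simp add: sum_distrib_right)
  also have "\<dots> \<le> (\<Sum>k\<le>p. real (?T choose k) * ?x ^ k)"
    using K by (intro sum_mono mult_left_mono power_decreasing) auto
  also have "\<dots> \<le> (\<Sum>k\<le>?T. real (?T choose k) * ?x ^ k)"
    using pT by (intro sum_mono2) auto
  also have "\<dots> = (?x + 1) ^ ?T"
    using binomial_ring[of ?x "1::real" ?T] by simp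
  also have "\<dots> \<le> exp ?x ^ ?T"
    using exp_ge_add_one_self[of ?x] by (intro power_mono) (auto simp: add.commute)
  also have "\<dots> = exp 1 ^ p"
  proof -
    have "exp ?x ^ K = exp (1::real)"
      using K0 by (simp add: exp_of_nat_mult[symmetric])
    then show ?thesis by (simp add: power_mult)
  qed
  finally have "real (\<Sum>k\<le>p. ?T choose k) * ?x ^ p * real K ^ p \<le> exp 1 ^ p * real K ^ p"
    by (rule mult_right_mono) simp
  moreover have "?x ^ p * real K ^ p = 1"
    using K0 by (simp add: power_mult_distrib[symmetric])
  ultimately show ?thesis by (simp add: power_mult_distrib mult.assoc)
qed

text \<open>The last summand on the left is the base-2 logarithm of the number of choices in one deletion step.\<close>

lemma potential_step:
  fixes r T m n X b :: real
  assumes "1 \<le> r" "0 < T" "0 \<le> m" "m \<le> n" "0 \<le> b"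
  defines "D \<equiv> (2 * r + 1) * n + 2 * (r * T)\<^sup>2 + r * T * X + n * b"
  shows "(r - 1) / r * (m - r * T)\<^sup>2 / 2 + D / (r * T) * (m - r * T)
      + (m * r + (r * T)\<^sup>2 + m + r * T * X + m * (r + b + (r - 1) * T))
    \<le> (r - 1) / r * m\<^sup>2 / 2 + D / (r * T) * m"
proof -
  \<comment> \<open>Here the main terms cancel: the quadratic term drops by
    \<open>(r - 1) * T * m\<close>, up to an \<open>m\<close>-free remainder, and this pays for the
    \<open>(r - 1) * T\<close> free bits of each vertex. The linear term drops by exactly
    \<open>D\<close>, which covers everything else.\<close>
  have 1: "(r - 1) / r * (m - r * T)\<^sup>2 / 2
      = (r - 1) / r * m\<^sup>2 / 2 - (r - 1) * T * m + (r - 1) * r * T\<^sup>2 / 2"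
    using assms by (simp add: field_simps power2_eq_square)
  have 2: "D / (r * T) * (m - r * T) = D / (r * T) * m - D"
    using assms by (simp add: field_simps)
  have 3: "(r - 1) * r * T\<^sup>2 / 2 \<le> (r * T)\<^sup>2"
  proof -
    have "(r - 1) * r * T\<^sup>2 \<le> r * r * T\<^sup>2"
      using assms by (intro mult_right_mono) auto
    moreover have "0 \<le> (r * T)\<^sup>2" by simp
    moreover have "r * r * T\<^sup>2 = (r * T)\<^sup>2" by (simp add: power2_eq_square)
    ultimately show ?thesis by linarith
  qed
  have 4: "m * (2 * r + 1) \<le> n * (2 * r + 1)" "m * b \<le> n * b"
    using assms by (auto intro: mult_right_mono)
  show ?thesis
    unfolding 1 2 using 3 4 unfolding D_def
    by (simp add: algebra_simps add_divide_distrib diff_divide_distrib)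
qed

text \<open>Strong induction on \<open>card V\<close>, deleting \<open>r * T\<close> vertices at a
  time. One deletion costs at most \<open>D\<close> beyond the quadratic term, whence the slope
  \<open>D / (r * T)\<close>; \<open>D\<close> is computed from \<open>n\<close>, so the same slope
  serves at every stage. \<open>\<Lambda>\<close> is the error inherited from graphs without the
  \<open>r\<close>-partite subgraph, and \<open>b\<close> bounds the binary logarithm of the
  binomial sum.\<close>

lemma card_multi_free_recursion:
  fixes r T p q n :: nat and b \<Lambda> :: real
  defines "c \<equiv> (real r - 1) / real r" and "X \<equiv> real (q * (T choose p) ^ r)"
  defines "D \<equiv> (2 * real r + 1) * real n + 2 * (real r * real T)\<^sup>2 + real r * real T * X + real n * b"
  assumes r: "1 \<le> r" and T: "1 \<le> T" and b: "0 \<le> b" "real (\<Sum>k\<le>p. T choose k) \<le> 2 powr b"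
    and lower: "\<And>V :: nat set. finite V \<Longrightarrow> card V \<le> n \<Longrightarrow>
      real (card (multi_free r (\<lambda>_. T) V)) \<le> 2 powr (c * (real (card V))\<^sup>2 / 2 + \<Lambda>)"
    and V: "finite (V :: nat set)" "card V \<le> n"
  shows "real (card (multi_free (Suc r) (part_sizes r p q) V))
    \<le> (real (card V) + 1) * 2 powr (c * (real (card V))\<^sup>2 / 2 + \<Lambda> + D / (real r * real T) * real (card V))"
  using V
proof (induction "card V" arbitrary: V rule: less_induct)
  case less
  define \<Psi> where "\<Psi> = (\<lambda>m::nat. c * (real m)\<^sup>2 / 2 + \<Lambda> + D / (real r * real T) * real m)"
  define m where "m = card V"
  have D0: "0 \<le> D" unfolding D_def X_def using b by simp
  have low: "real (card (multi_free r (\<lambda>_. T) V)) \<le> 2 powr \<Psi> m"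
  proof -
    have "c * (real m)\<^sup>2 / 2 + \<Lambda> \<le> \<Psi> m" unfolding \<Psi>_def using D0 by simp
    then show ?thesis using lower[OF less.prems] unfolding m_def[symmetric]
      by (meson order_trans powr_mono one_le_numeral)
  qed
  show ?case
  proof (cases "m < r * T")
    case True
    \<comment> \<open>With fewer than \<open>r * T\<close> vertices no admissible \<open>W\<close>
      exists, so \<open>M = 0\<close> is a valid bound and the second summand vanishes.\<close>
    have "card (multi_free (Suc r) (part_sizes r p q) V) \<le> card (multi_free r (\<lambda>_. T) V)"
      using card_multi_free_step[of V r T p q 0] less.prems r True by (auto simp: m_def)
    also have "real \<dots> \<le> 1 * 2 powr \<Psi> m" using low by simp
    also have "\<dots> \<le> (real m + 1) * 2 powr \<Psi> m" by (rule mult_right_mono) auto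
    finally show ?thesis unfolding \<Psi>_def m_def by simp
  next
    case False
    define m' where "m' = m - r * T"
    have "0 < r * T" using r T by simp
    then have m': "m' + r * T = m" "m' < m" using False unfolding m'_def by linarith+
    define y where "y = (real m' + 1) * 2 powr \<Psi> m'"
    have y0: "0 \<le> y" unfolding y_def by simp
    \<comment> \<open>The deletion step takes a natural number as bound; rounding down is harmless
      because it bounds a cardinality.\<close>
    define M where "M = nat \<lfloor>y\<rfloor>"
    have My: "real M \<le> y" unfolding M_def using y0 by simp
    define L where "L = r * (\<Sum>k\<le>p. T choose k) * 2 ^ ((r - 1) * T)"
    have step: "card (multi_free (Suc r) (part_sizes r p q) V)
      \<le> card (multi_free r (\<lambda>_. T) V) +
       (2 ^ m) ^ r * (M * (2 ^ (r * T)\<^sup>2 * (2 ^ m * (2 ^ (r * T * (q * (T choose p) ^ r)) * L ^ m))))"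
      unfolding m_def L_def
    proof (rule card_multi_free_step[OF less.prems(1)])
      show "0 < r" using r by simp
      fix W assume W: "W \<subseteq> V" "card W + r * T = card V"
      have "card W = m'" using W(2) m'(1) unfolding m_def by simp
      moreover have "finite W" using W(1) less.prems(1) finite_subset by blast
      ultimately have "real (card (multi_free (Suc r) (part_sizes r p q) W)) \<le> y"
        using less.hyps[of W] m' less.prems(2) unfolding y_def \<Psi>_def m_def by simp
      then show "card (multi_free (Suc r) (part_sizes r p q) W) \<le> M"
        unfolding M_def by (rule le_nat_floor)
    qed
    have L: "real L ^ m \<le> 2 powr (m * (real r + b + (real r - 1) * real T))"
    proof -
      have "real L = real r * real (\<Sum>k\<le>p. T choose k) * 2 ^ ((r - 1) * T)"
        unfolding L_def by simp
      also have "\<dots> \<le> 2 powr real r * 2 powr b * 2 powr ((real r - 1) * real T)"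
      proof (intro mult_mono)
        show "real r \<le> 2 powr real r"
          using less_exp[of r] by (simp add: powr_realpow less_imp_le)
        show "(2::real) ^ ((r - 1) * T) \<le> 2 powr ((real r - 1) * real T)"
          using r by (simp add: powr_realpow[symmetric] of_nat_diff)
      qed (use b in \<open>auto intro: sum_nonneg\<close>)
      also have "\<dots> = 2 powr (real r + b + (real r - 1) * real T)" by (simp add: powr_add)
      finally have "real L ^ m \<le> (2 powr (real r + b + (real r - 1) * real T)) ^ m"
        by (rule power_mono) simp
      then show ?thesis by (simp add: powr_realpow[symmetric] powr_powr mult.commute)
    qed
    let ?e = "real m * real r + (real r * real T)\<^sup>2 + real m + real r * real T * X
        + real m * (real r + b + (real r - 1) * real T)"
    have "real ((2 ^ m) ^ r * (M * (2 ^ (r * T)\<^sup>2 * (2 ^ m * (2 ^ (r * T * (q * (T choose p) ^ r)) * L ^ m)))))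
      = real M * (2 powr (real m * real r) * 2 powr ((real r * real T)\<^sup>2) * 2 powr real m
           * 2 powr (real r * real T * X) * real L ^ m)"
      unfolding X_def by (simp add: powr_realpow[symmetric] powr_powr)
    also have "\<dots> \<le> real M * (2 powr (real m * real r) * 2 powr ((real r * real T)\<^sup>2) * 2 powr real m
           * 2 powr (real r * real T * X) * 2 powr (m * (real r + b + (real r - 1) * real T)))"
      by (intro mult_left_mono L) auto
    also have "\<dots> = real M * 2 powr ?e" by (simp add: powr_add)
    also have "\<dots> \<le> y * 2 powr ?e" by (intro mult_right_mono My) auto
    also have "\<dots> = (real m' + 1) * 2 powr (\<Psi> m' + ?e)" unfolding y_def by (simp add: powr_add)
    \<comment> \<open>Since \<open>m' < m\<close>, the prefactor \<open>m' + 1\<close> is at most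
      \<open>m\<close>. The unit left over in \<open>m + 1\<close> pays for the graphs counted by
      \<open>low\<close>.\<close>
    also have "\<dots> \<le> real m * 2 powr \<Psi> m"
    proof (intro mult_mono powr_mono)
      have rm': "real m' = real m - real r * real T"
        using m'(1) by (metis add_diff_cancel_right' of_nat_add of_nat_mult)
      have "m \<le> n" using less.prems(2) m_def by simp
      then show "\<Psi> m' + ?e \<le> \<Psi> m"
        using potential_step[of "real r" "real T" "real m" "real n" b X] r T b
        unfolding \<Psi>_def c_def D_def rm' by (simp add: algebra_simps)
    qed (use m' in auto)
    finally have "real (card (multi_free (Suc r) (part_sizes r p q) V)) \<le> 2 powr \<Psi> m + real m * 2 powr \<Psi> m"
      using low step by linarith
    then show ?thesis unfolding \<Psi>_def m_def by (simp add: algebra_simps)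
  qed
qed

text \<open>For \<open>r = 0\<close> the density \<open>(r - 1) / r\<close> is \<open>0\<close> because of division by zero. This is the value
  that the induction needs, whereas the junk value of \<open>1 - 1 / r\<close> would be \<open>1\<close>.\<close>

definition few_multi_free :: "nat \<Rightarrow> bool" where
  "few_multi_free r \<longleftrightarrow> (\<forall>\<epsilon>>0. \<exists>C\<ge>1. \<exists>p0. \<forall>n p q. \<forall>V :: nat set.
     p0 \<le> p \<longrightarrow> 1 \<le> q \<longrightarrow> real q * exp (C * real p) \<le> real n \<longrightarrow> finite V \<longrightarrow> card V \<le> n \<longrightarrow>
     real (card (multi_free (Suc r) (part_sizes r p q) V))
       \<le> 2 powr ((real r - 1) / real r * (real (card V))\<^sup>2 / 2 + \<epsilon> * (real n)\<^sup>2))"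

section \<open>Induction on the number of parts\<close>

lemma le_exp_self: "(x::real) \<le> exp x"
  using exp_ge_add_one_self[of x] by linarith

text \<open>The forbidden graph is now just \<open>q\<close> vertices without edges, so only sets
  with \<open>card V < q\<close> admit any graph. Since
  \<open>q * p \<le> q * exp p \<le> n\<close>, there are at most \<open>2\<close> to the power
  \<open>\<epsilon> * n\<^sup>2\<close> graphs on such a set once
  \<open>p \<ge> 1 / \<epsilon>\<close>.\<close>

lemma few_multi_free_0: "few_multi_free 0"
  unfolding few_multi_free_def
proof (intro allI impI)
  fix \<epsilon> :: real assume \<epsilon>: "0 < \<epsilon>"
  define p0 where "p0 = nat \<lceil>1 / \<epsilon>\<rceil> + 1"
  have "real (card (multi_free (Suc 0) (part_sizes 0 p q) V))
       \<le> 2 powr ((real 0 - 1) / real 0 * (real (card V))\<^sup>2 / 2 + \<epsilon> * (real n)\<^sup>2)"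
    if p: "p0 \<le> p" and q: "1 \<le> q" "real q * exp (1 * real p) \<le> real n" and V: "finite V" "card V \<le> n"
    for n p q and V :: "nat set"
  proof (cases "q \<le> card V")
    case True
    then obtain Q where Q: "Q \<subseteq> V" "card Q = q" by (rule obtain_subset_with_card_n)
    have "has_multi (Suc 0) (part_sizes 0 p q) V E" for E
      unfolding has_multi_def spans_def using Q by (intro exI[of _ "\<lambda>_. Q"]) auto
    then have "multi_free (Suc 0) (part_sizes 0 p q) V = {}" unfolding multi_free_def by blast
    then show ?thesis by simp
  next
    case False
    have p1: "1 \<le> real p" "1 / \<epsilon> \<le> real p" using p unfolding p0_def by linarith+
    have "real q * real p \<le> real q * exp (real p)"
      using le_exp_self[of "real p"] by (intro mult_left_mono) auto
    then have qn: "real q * real p \<le> real n" using q(2) by simp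
    have "(real q)\<^sup>2 * 1 \<le> (real q)\<^sup>2 * (\<epsilon> * real p)"
      using p1(2) \<epsilon> by (intro mult_left_mono) (auto simp: field_simps)
    also have "\<dots> \<le> (real q)\<^sup>2 * (\<epsilon> * (real p)\<^sup>2)"
      using p1(1) \<epsilon> by (intro mult_left_mono) (auto simp: power2_eq_square)
    also have "\<dots> = \<epsilon> * (real q * real p)\<^sup>2" by (simp add: power_mult_distrib)
    also have "\<dots> \<le> \<epsilon> * (real n)\<^sup>2"
      using \<epsilon> qn by (intro mult_left_mono power_mono) auto
    finally have qe: "(real q)\<^sup>2 \<le> \<epsilon> * (real n)\<^sup>2" by simp
    have "(real (card V))\<^sup>2 \<le> (real q)\<^sup>2" using False by (intro power_mono) auto
    then have "(real (card V))\<^sup>2 \<le> \<epsilon> * (real n)\<^sup>2" using qe by linarith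
    then have "2 powr ((real (card V))\<^sup>2) \<le> 2 powr (\<epsilon> * (real n)\<^sup>2)"
      by (rule powr_mono) simp
    moreover have "real (card (multi_free (Suc 0) (part_sizes 0 p q) V)) \<le> real (2 ^ ((card V)\<^sup>2))"
      using card_multi_free_le_power[OF V(1)] by (rule of_nat_mono)
    moreover have "real (2 ^ ((card V)\<^sup>2)) = 2 powr ((real (card V))\<^sup>2)"
      by (simp add: powr_realpow[symmetric])
    ultimately have "real (card (multi_free (Suc 0) (part_sizes 0 p q) V)) \<le> 2 powr (\<epsilon> * (real n)\<^sup>2)"
      by linarith
    then show ?thesis by simp
  qed
  then show "\<exists>C\<ge>1. \<exists>p0. \<forall>n p q. \<forall>V :: nat set. p0 \<le> p \<longrightarrow> 1 \<le> q \<longrightarrow> real q * exp (C * real p) \<le> real n \<longrightarrow>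
     finite V \<longrightarrow> card V \<le> n \<longrightarrow> real (card (multi_free (Suc 0) (part_sizes 0 p q) V))
       \<le> 2 powr ((real 0 - 1) / real 0 * (real (card V))\<^sup>2 / 2 + \<epsilon> * (real n)\<^sup>2)"
    by (intro exI[of _ "1::real"] conjI exI[of _ p0] allI impI) simp_all
qed

text \<open>Lets the estimate for \<open>r\<close> be used at the density of \<open>Suc r\<close>.
  At \<open>r = 0\<close> both sides are \<open>0\<close>, the left one by division by zero.\<close>

lemma density_mono: "(real r - 1) / real r \<le> (real (Suc r) - 1) / real (Suc r)"
  by (cases "r = 0") (auto simp: field_simps)

text \<open>The induction hypothesis, applied with all parts of size \<open>T = K * p\<close>,
  supplies the lower-order bound that the recursion asks for. What remains is to choose
  \<open>K\<close>, then \<open>C\<close>, then \<open>p0\<close> so that the accumulated error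
  stays below \<open>\<epsilon> * n\<^sup>2\<close>.\<close>

lemma few_multi_free_Suc:
  assumes "few_multi_free r"
  shows "few_multi_free (Suc r)"
  unfolding few_multi_free_def
proof (intro allI impI)
  fix \<epsilon> :: real assume \<epsilon>: "0 < \<epsilon>"
  let ?s = "Suc r"
  from assms \<epsilon> obtain C' p0' where C': "1 \<le> C'" and low: "\<And>n p q. \<And>V :: nat set.
     p0' \<le> p \<Longrightarrow> 1 \<le> q \<Longrightarrow> real q * exp (C' * real p) \<le> real n \<Longrightarrow> finite V \<Longrightarrow> card V \<le> n \<Longrightarrow>
     real (card (multi_free (Suc r) (part_sizes r p q) V))
       \<le> 2 powr ((real r - 1) / real r * (real (card V))\<^sup>2 / 2 + \<epsilon> / 4 * (real n)\<^sup>2)"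
    unfolding few_multi_free_def by (metis divide_pos_pos zero_less_numeral)
  \<comment> \<open>The quotient is \<open>b / T\<close>: choosing a small neighbourhood in a part
    takes up to \<open>b\<close> bits, which must be few compared with \<open>T\<close>.\<close>
  have "(\<lambda>K. log 2 (exp 1 * real K) / real K) \<longlonglongrightarrow> 0"
    by real_asymp
  then have "eventually (\<lambda>K. log 2 (exp 1 * real K) / real K < \<epsilon> / 4) sequentially"
    using \<epsilon> by (intro order_tendstoD(2)) auto
  then have "eventually (\<lambda>K. log 2 (exp 1 * real K) / real K < \<epsilon> / 4 \<and> 1 \<le> K) sequentially"
    using eventually_ge_at_top[of 1] by (rule eventually_conj)
  then obtain K where K: "log 2 (exp 1 * real K) / real K < \<epsilon> / 4" "1 \<le> K"
    by (auto simp: eventually_sequentially)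
  \<comment> \<open>The first three groups of terms ensure, in turn, that the induction hypothesis
    applies at part size \<open>T\<close>, that \<open>T * p\<close> is at most of order
    \<open>n\<close>, and that \<open>X * p \<le> n\<close>.\<close>
  define C where "C = (C' + 1) * real K + 2 * real ?s * real K + real ?s * (1 + ln (real K)) + 1"
  \<comment> \<open>The errors of order \<open>1 / p\<close> add up to \<open>7 / p\<close>, which
    is at most \<open>\<epsilon> / 4\<close> from \<open>p = 28 / \<epsilon>\<close> on.\<close>
  define p0 where "p0 = p0' + nat \<lceil>28 / \<epsilon>\<rceil> + 1"
  have lnK: "0 \<le> ln (real K)" using K(2) by simp
  have Cge: "(C' + 1) * real K \<le> C" "2 * real ?s * real K \<le> C" "real ?s * (1 + ln (real K)) + 1 \<le> C" "1 \<le> C"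
    using lnK C' unfolding C_def by auto
  have "real (card (multi_free (Suc ?s) (part_sizes ?s p q) V))
       \<le> 2 powr ((real ?s - 1) / real ?s * (real (card V))\<^sup>2 / 2 + \<epsilon> * (real n)\<^sup>2)"
    if p: "p0 \<le> p" and q: "1 \<le> q" "real q * exp (C * real p) \<le> real n" and V: "finite V" "card V \<le> n"
    for n p q and V :: "nat set"
  proof -
    define T where "T = K * p"
    define b where "b = real p * log 2 (exp 1 * real K)"
    define X where "X = real (q * (T choose p) ^ ?s)"
    define D where "D = (2 * real ?s + 1) * real n + 2 * (real ?s * real T)\<^sup>2 + real ?s * real T * X + real n * b"
    have p1: "1 \<le> real p" "28 / \<epsilon> \<le> real p" "p0' \<le> p" using p unfolding p0_def by linarith+
    have Tp: "p \<le> T" using K(2) unfolding T_def by simp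
    have T1: "1 \<le> T" "p0' \<le> T" using p1 Tp by linarith+
    have "1 * exp (C * real p) \<le> real q * exp (C * real p)"
      using q(1) by (intro mult_right_mono) auto
    then have expn: "exp (C * real p) \<le> real n" using q(2) by linarith
    have eK: "1 \<le> exp 1 * real K"
      using K(2) exp_ge_add_one_self[of 1] mult_mono[of 1 "exp 1" 1 "real K"] by simp
    have b0: "0 \<le> b" unfolding b_def using eK by simp
    have bpow: "(exp 1 * real K) ^ p = 2 powr b"
    proof -
      have "2 powr b = (2 powr log 2 (exp 1 * real K)) powr real p"
        unfolding b_def by (simp only: powr_powr mult.commute)
      also have "2 powr log 2 (exp 1 * real K) = exp 1 * real K"
        using eK by (intro powr_log_cancel) linarith+
      also have "(exp 1 * real K) powr real p = (exp 1 * real K) ^ p"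
        using eK by (intro powr_realpow) linarith
      finally show ?thesis by simp
    qed
    have B: "real (\<Sum>k\<le>p. T choose k) \<le> (exp 1 * real K) ^ p"
      using sum_choose_le[OF K(2)] unfolding T_def .
    have lower: "real (card (multi_free ?s (\<lambda>_. T) V'))
        \<le> 2 powr ((real ?s - 1) / real ?s * (real (card V'))\<^sup>2 / 2 + \<epsilon> / 4 * (real n)\<^sup>2)"
      if V': "finite V'" "card V' \<le> n" for V' :: "nat set"
    proof -
      have "real T * exp (C' * real T) \<le> exp (real T) * exp (C' * real T)"
        by (intro mult_right_mono le_exp_self) auto
      also have "\<dots> = exp ((C' + 1) * real K * real p)"
        unfolding T_def by (simp add: exp_add[symmetric] algebra_simps)
      also have "\<dots> \<le> exp (C * real p)" using Cge(1) by (simp add: mult_right_mono)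
      finally have "real T * exp (C' * real T) \<le> real n" using expn by linarith
      \<comment> \<open>The last part also has size \<open>T\<close>, so
        \<open>part_sizes r T T\<close> is the constant function and \<open>q = T\<close> in the
        induction hypothesis.\<close>
      then have "real (card (multi_free ?s (part_sizes r T T) V'))
          \<le> 2 powr ((real r - 1) / real r * (real (card V'))\<^sup>2 / 2 + \<epsilon> / 4 * (real n)\<^sup>2)"
        using T1 V' by (intro low) auto
      also have "\<dots> \<le> 2 powr ((real ?s - 1) / real ?s * (real (card V'))\<^sup>2 / 2 + \<epsilon> / 4 * (real n)\<^sup>2)"
        using density_mono[of r] by (intro powr_mono add_right_mono divide_right_mono mult_right_mono) auto
      finally show ?thesis by simp
    qed
    have D0: "0 \<le> D" unfolding D_def X_def using b0 by simp
    \<comment> \<open>The extra factor \<open>p\<close> is absorbed by the final \<open>+ 1\<close>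
      in \<open>s * (1 + ln K) + 1\<close>, with \<open>s = Suc r\<close>; the rest of that exponent
      bounds \<open>(T choose p) ^ s\<close>.\<close>
    have Xp: "X * real p \<le> real n"
    proof -
      have "real (T choose p) \<le> real (\<Sum>k\<le>p. T choose k)"
        by (intro of_nat_mono member_le_sum) auto
      then have "real (T choose p) \<le> (exp 1 * real K) ^ p" using B by linarith
      also have "\<dots> = exp ((1 + ln (real K)) * real p)"
      proof -
        have "exp (1 + ln (real K)) = exp 1 * real K" using K(2) by (simp add: exp_add)
        then show ?thesis by (metis exp_of_nat2_mult)
      qed
      finally have "real (T choose p) ^ ?s \<le> exp ((1 + ln (real K)) * real p) ^ ?s"
        by (intro power_mono) auto
      then have "X \<le> real q * exp ((1 + ln (real K)) * real p * real ?s)"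
        unfolding X_def exp_of_nat2_mult by (simp add: mult_left_mono)
      then have "X * real p \<le> real q * exp ((1 + ln (real K)) * real p * real ?s) * exp (real p)"
        by (intro mult_mono le_exp_self) (auto simp: X_def)
      also have "\<dots> = real q * exp ((real ?s * (1 + ln (real K)) + 1) * real p)"
        by (simp add: exp_add[symmetric] algebra_simps)
      also have "\<dots> \<le> real q * exp (C * real p)"
        using Cge(3) by (intro mult_left_mono) (auto intro!: mult_right_mono)
      finally show ?thesis using q(2) by linarith
    qed
    have pn: "real p \<le> real n"
    proof -
      have "1 * real p \<le> C * real p" using Cge(4) by (intro mult_right_mono) auto
      then show ?thesis using le_exp_self[of "C * real p"] expn by linarith
    qed
    have Tn: "2 * (real ?s * real T) * real p \<le> 2 * real n"
    proof -
      have "2 * (real ?s * real T) * real p = (2 * real ?s * real K) * real p * real p" unfolding T_def by simp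
      also have "\<dots> \<le> (C * real p)\<^sup>2"
      proof -
        have "C \<le> C * C" using Cge(4) by simp
        then have "2 * real ?s * real K \<le> C * C" using Cge(2) by linarith
        then have "2 * real ?s * real K * real p * real p \<le> C * C * real p * real p"
          by (intro mult_right_mono) auto
        then show ?thesis by (simp add: power2_eq_square mult_ac)
      qed
      also have "\<dots> \<le> 2 * exp (C * real p)"
      proof -
        have Cp: "0 \<le> C * real p" using Cge(4) by simp
        show ?thesis using exp_lower_Taylor_quadratic[OF Cp] Cp by linarith
      qed
      finally show ?thesis using expn by linarith
    qed
    \<comment> \<open>The summand \<open>n\<close> comes from the prefactor
      \<open>card V + 1 \<le> 2 ^ n\<close>. In units of \<open>n\<^sup>2\<close>, the four pieces
      of \<open>D\<close> cost \<open>3 / p\<close>, \<open>2 / p\<close>, \<open>1 / p\<close> and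
      \<open>\<epsilon> / 4\<close>, and the summand \<open>n\<close> another
      \<open>1 / p\<close>.\<close>
    have err: "real n + D / (real ?s * real T) * real n \<le> \<epsilon> / 2 * (real n)\<^sup>2"
    proof -
      have sT: "0 < real ?s * real T" using T1 by simp
      have p0: "0 < real p" using p1 by linarith
      have n0: "0 \<le> real n" by simp
      have "D / (real ?s * real T) * real n = (2 * real ?s + 1) / (real ?s * real T) * (real n)\<^sup>2
          + 2 * (real ?s * real T) * real n + X * real n + b / (real ?s * real T) * (real n)\<^sup>2"
      proof -
        have "(A * N + 2 * S\<^sup>2 + S * Y + N * z) / S * N = A / S * N\<^sup>2 + 2 * S * N + Y * N + z / S * N\<^sup>2"
          if "0 < S" for A N S Y z :: real
          using that by (simp add: field_simps power2_eq_square)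
        from this[OF sT] show ?thesis unfolding D_def .
      qed
      moreover have "(2 * real ?s + 1) / (real ?s * real T) * (real n)\<^sup>2 \<le> 3 / real p * (real n)\<^sup>2"
      proof (rule mult_right_mono)
        have "(2 * real ?s + 1) * real p \<le> 3 * real ?s * real T"
          using Tp by (intro mult_mono) auto
        then show "(2 * real ?s + 1) / (real ?s * real T) \<le> 3 / real p"
          using sT p0 by (simp add: divide_le_eq le_divide_eq mult_ac)
      qed simp
      moreover have "2 * (real ?s * real T) * real n \<le> 2 / real p * (real n)\<^sup>2"
      proof -
        have "2 * (real ?s * real T) \<le> 2 * real n / real p" using Tn p0 by (simp add: le_divide_eq)
        from mult_right_mono[OF this n0] show ?thesis by (simp add: power2_eq_square)
      qed
      moreover have "X * real n \<le> 1 / real p * (real n)\<^sup>2"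
      proof -
        have "X \<le> real n / real p" using Xp p0 by (simp add: le_divide_eq)
        from mult_right_mono[OF this n0] show ?thesis by (simp add: power2_eq_square)
      qed
      moreover have "real n \<le> 1 / real p * (real n)\<^sup>2"
      proof -
        have "1 \<le> real n / real p" using pn p0 by (simp add: le_divide_eq)
        from mult_right_mono[OF this n0] show ?thesis by (simp add: power2_eq_square)
      qed
      moreover have "b / (real ?s * real T) * (real n)\<^sup>2 \<le> \<epsilon> / 4 * (real n)\<^sup>2"
      proof (rule mult_right_mono)
        have "b / (real ?s * real T) \<le> b / real T"
          using b0 T1 by (intro divide_left_mono) auto
        also have "\<dots> = log 2 (exp 1 * real K) / real K" unfolding b_def T_def using p0 by simp
        finally show "b / (real ?s * real T) \<le> \<epsilon> / 4" using K(1) by linarith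
      qed simp
      moreover have "7 / real p * (real n)\<^sup>2 \<le> \<epsilon> / 4 * (real n)\<^sup>2"
        using p1(2) p0 \<epsilon> by (intro mult_right_mono) (auto simp: field_simps)
      moreover have "7 / real p * (real n)\<^sup>2 = 3 / real p * (real n)\<^sup>2 + 2 / real p * (real n)\<^sup>2
          + 1 / real p * (real n)\<^sup>2 + 1 / real p * (real n)\<^sup>2"
        by (simp add: add_divide_distrib[symmetric] distrib_right[symmetric])
      ultimately show ?thesis by linarith
    qed
    let ?c = "(real ?s - 1) / real ?s * (real (card V))\<^sup>2 / 2"
    have "real (card (multi_free (Suc ?s) (part_sizes ?s p q) V))
      \<le> (real (card V) + 1) * 2 powr (?c + \<epsilon> / 4 * (real n)\<^sup>2 + D / (real ?s * real T) * real (card V))"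
      unfolding D_def X_def
      by (rule card_multi_free_recursion) (use T1 b0 B bpow lower V in auto)
    also have "\<dots> \<le> 2 powr real n * 2 powr (?c + \<epsilon> / 4 * (real n)\<^sup>2 + D / (real ?s * real T) * real n)"
    proof (intro mult_mono powr_mono add_left_mono mult_left_mono)
      have "n + 1 \<le> 2 ^ n" using less_exp[of n] by linarith
      then have "real (n + 1) \<le> real (2 ^ n)" by (rule of_nat_mono)
      then show "real (card V) + 1 \<le> 2 powr real n" using V(2) by (simp add: powr_realpow)
    qed (use D0 V in auto)
    also have "\<dots> = 2 powr (real n + (?c + \<epsilon> / 4 * (real n)\<^sup>2 + D / (real ?s * real T) * real n))"
      by (simp add: powr_add)
    also have "\<dots> \<le> 2 powr (?c + \<epsilon> * (real n)\<^sup>2)"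
    proof (rule powr_mono)
      have "\<epsilon> / 2 * (real n)\<^sup>2 + \<epsilon> / 4 * (real n)\<^sup>2 \<le> \<epsilon> * (real n)\<^sup>2"
        using \<epsilon> by (simp add: distrib_right[symmetric])
      then show "real n + (?c + \<epsilon> / 4 * (real n)\<^sup>2 + D / (real ?s * real T) * real n) \<le> ?c + \<epsilon> * (real n)\<^sup>2"
        using err by linarith
    qed simp
    finally show ?thesis .
  qed
  then show "\<exists>C\<ge>1. \<exists>p0. \<forall>n p q. \<forall>V :: nat set. p0 \<le> p \<longrightarrow> 1 \<le> q \<longrightarrow> real q * exp (C * real p) \<le> real n \<longrightarrow>
     finite V \<longrightarrow> card V \<le> n \<longrightarrow> real (card (multi_free (Suc ?s) (part_sizes ?s p q) V))
       \<le> 2 powr ((real ?s - 1) / real ?s * (real (card V))\<^sup>2 / 2 + \<epsilon> * (real n)\<^sup>2)"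
    using Cge(4) by (intro exI[of _ C] conjI exI[of _ p0] allI impI) simp_all
qed

lemma few_multi_free: "few_multi_free r"
  by (induction r) (auto intro: few_multi_free_0 few_multi_free_Suc)

section \<open>Labelled graphs and the Turan lower bound\<close>

text \<open>Enumerating each part separately gives the embedding; vertices of different parts have
  different images because the parts are disjoint.\<close>

lemma has_multi_imp_contains_copy:
  assumes V: "finite V" and E: "E \<subseteq> nsets V 2" and "has_multi k s V E"
  shows "contains_copy (V, E) (complete_multipartite k s)"
proof -
  obtain P where P: "\<And>i. i < k \<Longrightarrow> P i \<subseteq> V" "\<And>i. i < k \<Longrightarrow> card (P i) = s i" "spans k P E"
    using assms(3) unfolding has_multi_def by blast
  have "\<forall>i\<in>{..<k}. \<exists>h. bij_betw h {0..<s i} (P i)"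
    using P V by (metis ex_bij_betw_nat_finite finite_subset lessThan_iff)
  from bchoice[OF this] obtain g where "\<forall>i\<in>{..<k}. bij_betw (g i) {0..<s i} (P i)" ..
  then have g: "inj_on (g i) {..<s i}" "g i ` {..<s i} = P i" if "i < k" for i
    using that unfolding bij_betw_def by (auto simp: atLeast0LessThan)
  define W where "W = (SIGMA i:{..<k}. {..<s i})"
  define f where "f = (\<lambda>(i, x). g i x)"
  have fP: "f u \<in> P (fst u)" if "u \<in> W" for u
    using that g(2)[of "fst u"] unfolding W_def f_def by (cases u) auto
  have "inj_on f W"
  proof (rule inj_onI)
    fix u v assume uv: "u \<in> W" "v \<in> W" "f u = f v"
    have ij: "fst u < k" "fst v < k" using uv unfolding W_def by auto
    have "fst u = fst v"
      using spans_disjoint[OF P(3) E ij] fP[OF uv(1)] fP[OF uv(2)] uv(3) by auto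
    then show "u = v"
      using uv g(1)[OF ij(1)] unfolding W_def f_def inj_on_def by (cases u; cases v) auto
  qed
  moreover have "f ` W \<subseteq> V" using fP P(1) unfolding W_def by fastforce
  moreover have "f ` e \<in> E" if el: "e \<in> {{u, v} | u v. u \<in> W \<and> v \<in> W \<and> fst u \<noteq> fst v}" for e
  proof -
    obtain u v where e: "e = {u, v}" "u \<in> W" "v \<in> W" "fst u \<noteq> fst v" using el by blast
    have "fst u < k" "fst v < k" using e unfolding W_def by auto
    then have "{f u, f v} \<in> E"
      using P(3) fP[OF e(2)] fP[OF e(3)] e(4) unfolding spans_def by blast
    then show ?thesis using e(1) by simp
  qed
  ultimately show ?thesis
    unfolding contains_copy_def complete_multipartite_def Let_def W_def by (intro exI[of _ f]) simp
qed

lemma finite_labelled_graphs: "finite (labelled_graphs n)"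
proof (rule finite_subset)
  show "labelled_graphs n \<subseteq> {{1..n}} \<times> Pow (nsets {1..n} 2)"
    unfolding labelled_graphs_def by auto
qed (simp add: finite_nsets2)

lemma card_labelled_graphs_le: "card (labelled_graphs n) \<le> 2 ^ (n choose 2)"
proof -
  have "card (labelled_graphs n) \<le> card ({{1..n}} \<times> Pow (nsets {1..n} 2))"
    unfolding labelled_graphs_def by (rule card_mono) (auto simp: finite_nsets2)
  then show ?thesis by (simp add: card_cartesian_product card_Pow finite_nsets2)
qed

lemma finite_free_graphs: "finite (free_graphs n F)"
  using finite_labelled_graphs unfolding free_graphs_def by auto

lemma card_free_graphs_le_multi_free:
  "card (free_graphs n (complete_multipartite k s)) \<le> card (multi_free k s {1..n})"
proof (rule card_inj_on_le[of snd])
  show "inj_on snd (free_graphs n (complete_multipartite k s))"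
    by (rule inj_onI) (auto simp: free_graphs_def labelled_graphs_def prod_eq_iff)
  show "snd ` free_graphs n (complete_multipartite k s) \<subseteq> multi_free k s {1..n}"
    using has_multi_imp_contains_copy[of "{1..n}" _ k s]
    unfolding free_graphs_def labelled_graphs_def multi_free_def by auto
qed (simp add: finite_multi_free)

text \<open>The Turan graph, with the residue classes modulo \<open>r\<close> as parts; their sizes
  differ by at most one.\<close>

definition turan_edges :: "nat \<Rightarrow> nat \<Rightarrow> nat set set" where
  "turan_edges r n = {e \<in> nsets {1..n} 2. \<forall>x\<in>e. \<forall>y\<in>e. x \<noteq> y \<longrightarrow> x mod r \<noteq> y mod r}"

text \<open>Such an \<open>x\<close> equals \<open>y - r * k\<close> with
  \<open>1 \<le> k \<le> (y - 1) div r\<close>, and \<open>k\<close> determines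
  \<open>x\<close>.\<close>

lemma card_congruent_below_le:
  assumes r: "0 < (r::nat)"
  shows "r * card {x. 1 \<le> x \<and> x < y \<and> x mod r = y mod r} \<le> y - 1"
proof -
  let ?S = "{x. 1 \<le> x \<and> x < y \<and> x mod r = y mod r}"
  have dv: "\<exists>k. y = x + r * k" if "x \<in> ?S" for x
  proof -
    have "x \<le> y" "r dvd y - x" using that mod_eq_dvd_iff_nat[of x y r] by auto
    then show ?thesis by (metis dvdE le_add_diff_inverse)
  qed
  have "card ?S \<le> card {1..(y - 1) div r}"
  proof (rule card_inj_on_le)
    show "inj_on (\<lambda>x. (y - x) div r) ?S"
    proof (rule inj_onI)
      fix x x' assume x: "x \<in> ?S" "x' \<in> ?S" and eq: "(y - x) div r = (y - x') div r"
      obtain k k' where k: "y = x + r * k" "y = x' + r * k'" using dv x by blast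
      have "y - x = r * k" "y - x' = r * k'" using k by linarith+
      then have "k = k'" using eq r by simp
      then show "x = x'" using k by simp
    qed
    show "(\<lambda>x. (y - x) div r) ` ?S \<subseteq> {1..(y - 1) div r}"
    proof
      fix z assume "z \<in> (\<lambda>x. (y - x) div r) ` ?S"
      then obtain x where x: "x \<in> ?S" "z = (y - x) div r" by blast
      obtain k where k: "y = x + r * k" using dv x by blast
      then have "z = k" using x r by simp
      moreover have "k \<noteq> 0" using k x by (intro notI) simp
      moreover have "z \<le> (y - 1) div r" unfolding x(2) using x(1) by (intro div_le_mono) auto
      ultimately show "z \<in> {1..(y - 1) div r}" by simp
    qed
  qed simp
  then have "r * card ?S \<le> r * ((y - 1) div r)" by simp
  also have "\<dots> \<le> y - 1" by simp
  finally show ?thesis .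
qed

text \<open>Non-edges are counted by their larger endpoint \<open>y\<close>, at most
  \<open>(y - 1) / r\<close> for each. Summing over \<open>y\<close> gives
  \<open>(n choose 2) / r\<close> for every \<open>n\<close>, without computing class sizes.\<close>

lemma card_turan_edges_ge:
  assumes r: "0 < r"
  shows "(1 - 1 / real r) * real (n choose 2) \<le> real (card (turan_edges r n))"
proof -
  let ?S = "\<lambda>y. {x. 1 \<le> x \<and> x < y \<and> x mod r = y mod r}"
  let ?N = "\<Union>y\<in>{1..n}. (\<lambda>x. {x, y}) ` ?S y"
  have finS: "finite (?S y)" for y by (rule finite_subset[of _ "{..<y}"]) auto
  have sub: "nsets {1..n} 2 \<subseteq> turan_edges r n \<union> ?N"
  proof
    fix e assume e: "e \<in> nsets {1..n} 2"
    show "e \<in> turan_edges r n \<union> ?N"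
    proof (cases "e \<in> turan_edges r n")
      case False
      then obtain x y where xy: "x \<in> e" "y \<in> e" "x \<noteq> y" "x mod r = y mod r"
        using e unfolding turan_edges_def by blast
      have "card e = 2" "e \<subseteq> {1..n}" "finite e" using e by (auto simp: nsets_def)
      then have "e = {x, y}" using xy by (metis card_2_iff insert_absorb2 insertE insert_commute singletonD)
      then have "e = {min x y, max x y}" "min x y < max x y" "1 \<le> min x y" "max x y \<le> n"
        "min x y mod r = max x y mod r"
        using xy \<open>e \<subseteq> {1..n}\<close> by (auto simp: min_def max_def)
      then have "e \<in> (\<lambda>x'. {x', max x y}) ` ?S (max x y)" "max x y \<in> {1..n}" by auto
      then show ?thesis by blast
    qed simp
  qed
  have "n choose 2 = card (nsets {1..n} 2)" by simp
  also have "\<dots> \<le> card (turan_edges r n \<union> ?N)"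
  proof (rule card_mono[OF _ sub])
    have "finite (turan_edges r n)"
      unfolding turan_edges_def by (simp add: finite_nsets2)
    then show "finite (turan_edges r n \<union> ?N)" using finS by blast
  qed
  also have "\<dots> \<le> card (turan_edges r n) + card ?N" by (rule card_Un_le)
  finally have 1: "n choose 2 \<le> card (turan_edges r n) + card ?N" .
  have "card ?N \<le> (\<Sum>y\<in>{1..n}. card ((\<lambda>x. {x, y}) ` ?S y))" by (rule card_UN_le) simp
  also have "\<dots> \<le> (\<Sum>y\<in>{1..n}. card (?S y))" by (intro sum_mono card_image_le finS)
  finally have "r * card ?N \<le> (\<Sum>y\<in>{1..n}. r * card (?S y))"
    by (simp add: sum_distrib_left[symmetric])
  also have "\<dots> \<le> (\<Sum>y\<in>{1..n}. y - 1)" by (intro sum_mono card_congruent_below_le r)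
  also have "\<dots> = n choose 2"
  proof (induction n)
    case (Suc n)
    then show ?case by (simp add: numeral_2_eq_2)
  qed simp
  finally have "real (r * card ?N) \<le> real (n choose 2)" by (rule of_nat_mono)
  then have "real (card ?N) \<le> real (n choose 2) / real r"
    using r by (simp add: le_divide_eq mult.commute)
  moreover have "real (n choose 2) \<le> real (card (turan_edges r n)) + real (card ?N)"
    using 1 by linarith
  ultimately show ?thesis by (simp add: algebra_simps)
qed

text \<open>Pigeonhole: one vertex \<open>(i, 0)\<close> from each of the \<open>r + 1\<close>
  nonempty parts gives pairwise adjacent images, which would need \<open>r + 1\<close> distinct
  residues modulo \<open>r\<close>.\<close>

lemma turan_subgraph_free:
  assumes r: "0 < r" and s: "\<And>i. i \<le> r \<Longrightarrow> 0 < s i" and E: "E \<subseteq> turan_edges r n"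
  shows "\<not> contains_copy ({1..n}, E) (complete_multipartite (r + 1) s)"
proof
  assume "contains_copy ({1..n}, E) (complete_multipartite (r + 1) s)"
  then obtain f where f: "\<And>e. e \<in> edges (complete_multipartite (r + 1) s) \<Longrightarrow> f ` e \<in> E"
    unfolding contains_copy_def by auto
  have "inj_on (\<lambda>i. f (i, 0) mod r) {..r}"
  proof (rule inj_onI, rule ccontr)
    fix i j assume ij: "i \<in> {..r}" "j \<in> {..r}" and eq: "f (i, 0) mod r = f (j, 0) mod r" and ne: "i \<noteq> j"
    have "{(i, 0), (j, 0)} \<in> edges (complete_multipartite (r + 1) s)"
      unfolding complete_multipartite_def Let_def snd_conv
      by (intro CollectI exI[of _ "(i, 0)"] exI[of _ "(j, 0)"]) (use ij ne s in auto)
    from f[OF this] have "{f (i, 0), f (j, 0)} \<in> turan_edges r n" using E by auto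
    then have "card {f (i, 0), f (j, 0)} = 2"
      "f (i, 0) \<noteq> f (j, 0) \<longrightarrow> f (i, 0) mod r \<noteq> f (j, 0) mod r"
      unfolding turan_edges_def nsets_def by auto
    then show False using eq by (cases "f (i, 0) = f (j, 0)") auto
  qed
  then have "card {..r} \<le> card {..<r}" by (rule card_inj_on_le) (use r in auto)
  then show False by simp
qed

lemma card_free_graphs_ge:
  assumes r: "0 < r" and s: "\<And>i. i \<le> r \<Longrightarrow> 0 < s i"
  shows "2 ^ card (turan_edges r n) \<le> card (free_graphs n (complete_multipartite (r + 1) s))"
proof -
  have "turan_edges r n \<subseteq> nsets {1..n} 2" unfolding turan_edges_def by blast
  then have fin: "finite (turan_edges r n)" and
    sub: "Pair {1..n} ` Pow (turan_edges r n) \<subseteq> free_graphs n (complete_multipartite (r + 1) s)"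
    using turan_subgraph_free[OF r s] finite_subset[OF _ finite_nsets2[of "{1..n}"]]
    unfolding free_graphs_def labelled_graphs_def by auto
  have "card (Pair {1..n} ` Pow (turan_edges r n)) = 2 ^ card (turan_edges r n)"
    using fin by (simp add: card_image card_Pow inj_on_def)
  then show ?thesis using card_mono[OF finite_free_graphs sub] by simp
qed

lemma log_card_free_graphs_ge:
  assumes "0 < r" "0 < p" "0 < q"
  shows "(1 - 1 / real r) * real (n choose 2) \<le> log 2 (real (card (free_graphs n (K_multi r p q))))"
    and "0 < card (free_graphs n (K_multi r p q))"
proof -
  have ge: "2 ^ card (turan_edges r n) \<le> card (free_graphs n (K_multi r p q))"
    unfolding K_multi_def by (rule card_free_graphs_ge) (use assms in auto)
  then have "0 < (2::nat) ^ card (turan_edges r n)" "real (2 ^ card (turan_edges r n)) \<le> real (card (free_graphs n (K_multi r p q)))"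
    by (simp_all only: of_nat_mono) simp
  then show "0 < card (free_graphs n (K_multi r p q))" using ge by linarith
  then have "real (card (turan_edges r n)) \<le> log 2 (real (card (free_graphs n (K_multi r p q))))"
    using \<open>real (2 ^ _) \<le> _\<close> by (simp add: le_log_iff powr_realpow)
  then show "(1 - 1 / real r) * real (n choose 2) \<le> log 2 (real (card (free_graphs n (K_multi r p q))))"
    using card_turan_edges_ge[OF assms(1), of n] by linarith
qed

section \<open>Choice of delta and conclusion\<close>

theorem theorem1:
  fixes \<epsilon> :: real
  assumes "0 < \<epsilon>" and "\<epsilon> \<le> 1/2"
  shows "\<exists>\<delta>>0. \<forall>r::nat. 2 \<le> r \<longrightarrow> (\<forall>\<^sub>F n::nat in sequentially.
           (1 - 1 / real r) * real (n choose 2)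
             \<le> log 2 (real (card (free_graphs n
                  (K_multi r (nat \<lfloor>\<delta> * ln (real n)\<rfloor>) (nat \<lceil>real n powr (1 - sqrt \<delta>)\<rceil>)))))
         \<and> log 2 (real (card (free_graphs n
                  (K_multi r (nat \<lfloor>\<delta> * ln (real n)\<rfloor>) (nat \<lceil>real n powr (1 - sqrt \<delta>)\<rceil>)))))
             \<le> (1 - 1 / real r + \<epsilon>) * real (n choose 2))"
proof -
  have "\<forall>r. \<exists>C\<ge>1. \<exists>p0. \<forall>n p q. \<forall>V :: nat set.
     p0 \<le> p \<longrightarrow> 1 \<le> q \<longrightarrow> real q * exp (C * real p) \<le> real n \<longrightarrow> finite V \<longrightarrow> card V \<le> n \<longrightarrow>
     real (card (multi_free (Suc r) (part_sizes r p q) V))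
       \<le> 2 powr ((real r - 1) / real r * (real (card V))\<^sup>2 / 2 + \<epsilon> / 4 * (real n)\<^sup>2)"
    (is "\<forall>r. ?P r")
  proof
    fix r
    have "0 < \<epsilon> / 4" using assms(1) by simp
    from mp[OF spec[OF few_multi_free[of r, unfolded few_multi_free_def]] this] show "?P r" .
  qed
  then obtain C where C1: "\<And>r. 1 \<le> C r" and C: "\<And>r. \<exists>p0. \<forall>n p q. \<forall>V :: nat set.
     p0 \<le> p \<longrightarrow> 1 \<le> q \<longrightarrow> real q * exp (C r * real p) \<le> real n \<longrightarrow> finite V \<longrightarrow> card V \<le> n \<longrightarrow>
     real (card (multi_free (Suc r) (part_sizes r p q) V))
       \<le> 2 powr ((real r - 1) / real r * (real (card V))\<^sup>2 / 2 + \<epsilon> / 4 * (real n)\<^sup>2)"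
    unfolding choice_iff by blast
  \<comment> \<open>Beyond \<open>R\<close> the factor \<open>1 - 1 / r + \<epsilon>\<close> is at
    least \<open>1\<close> and the upper bound is trivial. Hence finitely many constants
    \<open>C r\<close> matter, and their sum \<open>D\<close> dominates each of them.\<close>
  define R where "R = nat \<lceil>1 / \<epsilon>\<rceil>"
  define D where "D = (\<Sum>r\<le>R. C r)"
  have CD: "C r \<le> D" if "r \<le> R" for r
    unfolding D_def using that C1 by (intro member_le_sum) (auto intro: order_trans[OF zero_le_one])
  have D1: "1 \<le> D" using CD[of 0] C1[of 0] by linarith
  \<comment> \<open>With \<open>x = sqrt \<delta>\<close>, the product of \<open>q\<close> and
    \<open>exp (D * p)\<close> is about \<open>n\<close> to the power
    \<open>1 - x + D * x\<^sup>2\<close>. The saving \<open>x - D * x\<^sup>2\<close> is largest at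
    \<open>x = 1 / (2 * D)\<close>, where it equals \<open>a\<close>.\<close>
  define \<delta> where "\<delta> = (1 / (2 * D))\<^sup>2"
  have \<delta>0: "0 < \<delta>" using D1 unfolding \<delta>_def by simp
  have sqrt\<delta>: "sqrt \<delta> = 1 / (2 * D)" using D1 unfolding \<delta>_def by simp
  define a where "a = 1 / (4 * D)"
  have a: "0 < a" "sqrt \<delta> - D * \<delta> = a"
    using D1 unfolding sqrt\<delta> unfolding \<delta>_def a_def by (auto simp: field_simps power2_eq_square)
  have "\<forall>\<^sub>F n in sequentially.
           (1 - 1 / real r) * real (n choose 2)
             \<le> log 2 (real (card (free_graphs n
                  (K_multi r (nat \<lfloor>\<delta> * ln (real n)\<rfloor>) (nat \<lceil>real n powr (1 - sqrt \<delta>)\<rceil>)))))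
         \<and> log 2 (real (card (free_graphs n
                  (K_multi r (nat \<lfloor>\<delta> * ln (real n)\<rfloor>) (nat \<lceil>real n powr (1 - sqrt \<delta>)\<rceil>)))))
             \<le> (1 - 1 / real r + \<epsilon>) * real (n choose 2)"
    if r: "2 \<le> r" for r
  proof -
    obtain p0 where p0: "\<And>n p q. \<And>V :: nat set. p0 \<le> p \<Longrightarrow> 1 \<le> q \<Longrightarrow> real q * exp (C r * real p) \<le> real n \<Longrightarrow>
      finite V \<Longrightarrow> card V \<le> n \<Longrightarrow> real (card (multi_free (Suc r) (part_sizes r p q) V))
       \<le> 2 powr ((real r - 1) / real r * (real (card V))\<^sup>2 / 2 + \<epsilon> / 4 * (real n)\<^sup>2)"
      using C[of r] by blast
    \<comment> \<open>The three conditions give \<open>p > p0\<close>, pay for rounding up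
      \<open>q\<close>, and absorb the difference between \<open>n\<^sup>2 / 2\<close> and
      \<open>n choose 2\<close>.\<close>
    have "\<forall>\<^sub>F n in sequentially. real (p0 + 1) \<le> \<delta> * ln (real n)"
      using \<delta>0 by real_asymp
    moreover have "\<forall>\<^sub>F n in sequentially. 2 \<le> real n powr a"
      using a(1) by real_asymp
    moreover have "\<forall>\<^sub>F n in sequentially. 2 / \<epsilon> + 2 \<le> real n"
      by real_asymp
    ultimately show ?thesis
    proof eventually_elim
      case (elim n)
      define p where "p = nat \<lfloor>\<delta> * ln (real n)\<rfloor>"
      define q where "q = nat \<lceil>real n powr (1 - sqrt \<delta>)\<rceil>"
      have n2: "2 < real n" using elim(3) assms(1) by (smt (verit) divide_pos_pos)
      have n0: "0 < real n" using n2 by simp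
      have p: "p0 + 1 \<le> p" unfolding p_def using elim(1) by (rule le_nat_floor)
      have "0 < real n powr (1 - sqrt \<delta>)" using n2 by simp
      then have q: "1 \<le> q" unfolding q_def by linarith
      have low: "(1 - 1 / real r) * real (n choose 2) \<le> log 2 (real (card (free_graphs n (K_multi r p q))))"
        and pos: "0 < card (free_graphs n (K_multi r p q))"
        using log_card_free_graphs_ge[of r p q n] r p q by auto
      have "log 2 (real (card (free_graphs n (K_multi r p q)))) \<le> (1 - 1 / real r + \<epsilon>) * real (n choose 2)"
      proof (cases "r \<le> R")
        case True
        \<comment> \<open>The ceiling costs at most a factor \<open>2\<close>, which
          \<open>n powr a\<close> outweighs.\<close>
        have "real q \<le> real n powr (1 - sqrt \<delta>) + 1" (is "_ \<le> ?x + 1")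
          using powr_ge_zero[of "real n" "1 - sqrt \<delta>"] unfolding q_def by linarith
        moreover have "1 \<le> ?x"
          using n2 D1 unfolding sqrt\<delta> by (intro ge_one_powr_ge_zero) (auto simp: field_simps)
        ultimately have q2: "real q \<le> 2 * real n powr (1 - sqrt \<delta>)" by linarith
        have "real p \<le> \<delta> * ln (real n)" unfolding p_def using \<delta>0 n2 by simp
        then have "C r * real p \<le> D * (\<delta> * ln (real n))"
          using CD[OF True] D1 by (intro mult_mono) auto
        then have "exp (C r * real p) \<le> real n powr (D * \<delta>)"
          using n0 by (simp add: powr_def mult.assoc)
        then have "real q * exp (C r * real p) \<le> 2 * real n powr (1 - sqrt \<delta>) * real n powr (D * \<delta>)"
          using q2 by (intro mult_mono) auto
        also have "\<dots> = 2 * real n powr (1 - a)"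
          unfolding a(2)[symmetric] by (simp add: powr_add[symmetric] algebra_simps)
        also have "\<dots> \<le> real n powr a * real n powr (1 - a)"
          using elim(2) by (intro mult_right_mono) auto
        also have "\<dots> = real n" using n0 by (simp add: powr_add[symmetric])
        finally have "real (card (multi_free (Suc r) (part_sizes r p q) {1..n}))
            \<le> 2 powr ((real r - 1) / real r * (real n)\<^sup>2 / 2 + \<epsilon> / 4 * (real n)\<^sup>2)"
          using p0[of p q n "{1..n}"] p q by simp
        moreover have "card (free_graphs n (K_multi r p q)) \<le> card (multi_free (Suc r) (part_sizes r p q) {1..n})"
          using card_free_graphs_le_multi_free[of n "Suc r" "part_sizes r p q"] unfolding K_multi_def by simp
        ultimately have "real (card (free_graphs n (K_multi r p q)))
            \<le> 2 powr ((real r - 1) / real r * (real n)\<^sup>2 / 2 + \<epsilon> / 4 * (real n)\<^sup>2)" by linarith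
        then have "log 2 (real (card (free_graphs n (K_multi r p q))))
            \<le> (real r - 1) / real r * (real n)\<^sup>2 / 2 + \<epsilon> / 4 * (real n)\<^sup>2"
          using pos by (subst log_le_iff) auto
        \<comment> \<open>Only \<open>\<epsilon> / 4\<close> of the available
          \<open>\<epsilon> / 2\<close> has been spent on \<open>n\<^sup>2\<close>. The rest covers
          the linear loss \<open>(c + \<epsilon>) * n / 2\<close> for large
          \<open>n\<close>.\<close>
        also have "\<dots> \<le> (1 - 1 / real r + \<epsilon>) * real (n choose 2)"
        proof -
          define c where "c = 1 - 1 / real r"
          have c: "(real r - 1) / real r = c" "0 \<le> c" "c \<le> 1" using r unfolding c_def by (auto simp: field_simps)
          have ch: "real (n choose 2) = real n * (real n - 1) / 2"
          proof -
            have "2 * (n choose 2) = n * (n - 1)"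
              unfolding choose_two by (rule dvd_mult_div_cancel) auto
            then have "2 * real (n choose 2) = real n * real (n - 1)"
              by (metis of_nat_mult of_nat_numeral)
            then show ?thesis using n2 by (simp add: of_nat_diff)
          qed
          have "2 + 2 * \<epsilon> \<le> \<epsilon> * real n"
            using elim(3) assms(1) by (simp add: field_simps)
          then have "(2 + 2 * \<epsilon>) * real n \<le> \<epsilon> * real n * real n"
            using n0 by (intro mult_right_mono) auto
          moreover have "c * real n \<le> 1 * real n" using c(3) n0 by (intro mult_right_mono) auto
          ultimately have "c * real n + \<epsilon> * real n \<le> \<epsilon> * real n * real n / 2" by (simp add: algebra_simps)
          then show ?thesis unfolding c(1) ch c_def[symmetric]
            by (simp add: algebra_simps power2_eq_square add_divide_distrib diff_divide_distrib)
        qed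
        finally show ?thesis .
      next
        case False
        have "1 / \<epsilon> \<le> real r" using False unfolding R_def by linarith
        then have "1 / real r \<le> \<epsilon>" using r assms(1) by (simp add: field_simps)
        then have "1 * real (n choose 2) \<le> (1 - 1 / real r + \<epsilon>) * real (n choose 2)"
          by (intro mult_right_mono) auto
        moreover have "log 2 (real (card (free_graphs n (K_multi r p q)))) \<le> real (n choose 2)"
        proof -
          have "card (free_graphs n (K_multi r p q)) \<le> card (labelled_graphs n)"
            unfolding free_graphs_def by (intro card_mono finite_labelled_graphs) auto
          then have "card (free_graphs n (K_multi r p q)) \<le> 2 ^ (n choose 2)"
            using card_labelled_graphs_le[of n] by linarith
          then have "real (card (free_graphs n (K_multi r p q))) \<le> real (2 ^ (n choose 2))"
            by (rule of_nat_mono)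
          then show ?thesis using pos by (subst log_le_iff) (auto simp: powr_realpow)
        qed
        ultimately show ?thesis by linarith
      qed
      with low show ?case unfolding p_def q_def by blast
    qed
  qed
  with \<delta>0 show ?thesis by blast
qed

end
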